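(* For every integer $N$ with $27\le N\le 55$, there exists a really perverse central configuration of the spatial Newtonian $N$-body problem. Explicitly: for every such $N$ there exist pairwise distinct points $c_1,\dots,c_N\in\mathbb{R}^3$, a real number $\lambda$, and two distinct mass distributions $(M_1,\dots,M_N)\neq(M_1',\dots,M_N')$ with all $M_k>0$ and all $M_k'>0$, such that for all $k=1,\dots,N$ $$\lambda M_k c_k=-\sum_{j\neq k}\frac{M_kM_j(c_k-c_j)}{|c_k-c_j|^3}\qquad\text{and}\qquad \lambda M_k' c_k=-\sum_{j\neq k}\frac{M_k'M_j'(c_k-c_j)}{|c_k-c_j|^3},$$ and the two mass distributions have the same total mass, $\sum_k M_k=\sum_k M_k'$, and the same center of mass, $\frac{\sum_k M_kc_k}{\sum_k M_k}=\frac{\sum_k M_k'c_k}{\sum_k M_k'}$.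
   Context: The Newtonian $N$-body problem in $\mathbb{R}^3$ is the system $\ddot Q_k=-\sum_{j\neq k}\frac{M_j(Q_k-Q_j)}{|Q_k-Q_j|^3}$, $k=1,\dots,N$, for positions $Q_k\in\mathbb{R}^3$ and positive masses $M_k$. A configuration $\bm{c}=(c_1,\dots,c_N)\in(\mathbb{R}^3)^N$ of pairwise distinct points is a central configuration for the masses $(M_1,\dots,M_N)$ if there exists $\lambda\in\mathbb{R}$ such that $\lambda M_kc_k=-\sum_{j\neq k}\frac{M_kM_j(c_k-c_j)}{|c_k-c_j|^3}$ for all $k=1,\dots,N$. A central configuration $\bm{c}$ is called really perverse if it satisfies this equation (with the same $\lambda$) for two distinct mass distributions $(M_1,\dots,M_N)\neq(M_1',\dots,M_N')$ having the same total mass and the same center of mass. Here $|\cdot|$ is the Euclidean norm. *)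

theory Defs
  imports "HOL-Analysis.Analysis"
begin

text \<open>
  Bodies are indexed by \<open>{1..N}\<close>; positions and masses are functions on \<open>nat\<close> of which only the
  values on \<open>{1..N}\<close> matter. In particular, distinctness of mass distributions must be
  stated on \<open>{1..N}\<close> and not as inequality of functions.
\<close>

definition mass_distribution :: "nat \<Rightarrow> (nat \<Rightarrow> real) \<Rightarrow> bool" where
  "mass_distribution N M \<longleftrightarrow> (\<forall>k\<in>{1..N}. M k > 0)"

definition configuration :: "nat \<Rightarrow> (nat \<Rightarrow> real ^ 3) \<Rightarrow> bool" where
  "configuration N c \<longleftrightarrow> inj_on c {1..N}"

definition cc_equation :: "nat \<Rightarrow> (nat \<Rightarrow> real) \<Rightarrow> real \<Rightarrow> (nat \<Rightarrow> real ^ 3) \<Rightarrow> bool" where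
  "cc_equation N M l c \<longleftrightarrow>
     (\<forall>k\<in>{1..N}. (l * M k) *\<^sub>R c k =
        - (\<Sum>j\<in>{1..N} - {k}. (M k * M j / norm (c k - c j) ^ 3) *\<^sub>R (c k - c j)))"

definition central_configuration :: "nat \<Rightarrow> (nat \<Rightarrow> real) \<Rightarrow> (nat \<Rightarrow> real ^ 3) \<Rightarrow> bool" where
  "central_configuration N M c \<longleftrightarrow>
     mass_distribution N M \<and> configuration N c \<and> (\<exists>l. cc_equation N M l c)"

definition total_mass :: "nat \<Rightarrow> (nat \<Rightarrow> real) \<Rightarrow> real" where
  "total_mass N M = (\<Sum>k\<in>{1..N}. M k)"

definition center_of_mass :: "nat \<Rightarrow> (nat \<Rightarrow> real) \<Rightarrow> (nat \<Rightarrow> real ^ 3) \<Rightarrow> real ^ 3" where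
  "center_of_mass N M c = (1 / total_mass N M) *\<^sub>R (\<Sum>k\<in>{1..N}. M k *\<^sub>R c k)"

definition really_perverse :: "nat \<Rightarrow> (nat \<Rightarrow> real ^ 3) \<Rightarrow> bool" where
  "really_perverse N c \<longleftrightarrow>
     (\<exists>l M M'.
        central_configuration N M c \<and> central_configuration N M' c \<and>
        cc_equation N M l c \<and> cc_equation N M' l c \<and>
        (\<exists>k\<in>{1..N}. M k \<noteq> M' k) \<and>
        total_mass N M = total_mass N M' \<and>
        center_of_mass N M c = center_of_mass N M' c)"

end

theory Submission
  imports Defs
begin

text \<open>
  Take a regular \<open>n\<close>-gon of radius 1, \<open>n = N - 3\<close>, its centre, and two points on the axis at height
  \<open>\<plusminus>h\<close>, with equal masses \<open>x\<close> on the polygon, \<open>w\<close> at the centre and \<open>y\<close> at each pole. By symmetry the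
  equations of a central configuration reduce to two linear equations in \<open>(x, w, y)\<close>, one for the
  polygon and one for the poles, so the difference of two solutions with the same \<open>\<lambda>\<close> and the same
  total mass solves a homogeneous \<open>3 \<times> 3\<close> system. With \<open>h = tan \<theta>\<close>, \<open>s = cos\<^sup>3 \<theta>\<close>, \<open>t = sin\<^sup>3 \<theta>\<close> and
  \<open>S = (\<Sum>d=1..<n. 1 / sin (\<pi> d / n))\<close>, this system is singular iff \<open>8 (s + t - s t) = 1 + 7 S / (4 n)\<close>.
  For \<open>\<pi>/6 < \<theta> < \<pi>/4\<close> there are positive masses, to which a small multiple of the kernel vector can be
  added, and by the intermediate value theorem such a \<open>\<theta>\<close> exists if
  \<open>(16 \<surd>2 - 8) / 7 < S / n < 3 \<surd>3 / 2\<close>. Since the cosecant is convex, \<open>S / n\<close> increases with \<open>n\<close>, and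
  the bounds need only be checked for \<open>n = 24\<close> and \<open>n = 52\<close>.
\<close>

section \<open>Cosecant sums\<close>

text \<open>Chords of the unit \<open>n\<close>-gon have length \<open>2 * sin (pi * d / n)\<close>;
  a quarter of this sum is the pull, directed to the centre, that unit masses at the vertices exert
  on one of them.\<close>

definition csc_sum :: "nat \<Rightarrow> real" where
  "csc_sum n = (\<Sum>d=1..<n. 1 / sin (pi * real d / real n))"

section \<open>Polynomial enclosures of sine, \<open>pi\<close> and cosecant\<close>

lemma sin_le_poly5:
  fixes x :: real
  assumes "0 \<le> x"
  shows "sin x \<le> x - x^3/6 + x^5/120"
proof -
  have "(\<Sum>m<5. sin_coeff m * x ^ m) = x - x^3/6"
    by (simp add: eval_nat_numeral sin_coeff_Suc cos_coeff_Suc)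
  with Maclaurin_sin_bound[of x 5] assms have "\<bar>sin x - (x - x^3/6)\<bar> \<le> x^5/120"
    by (simp add: fact_numeral)
  then show ?thesis by linarith
qed

lemma sin_ge_poly7:
  fixes x :: real
  assumes "0 \<le> x"
  shows "x - x^3/6 + x^5/120 - x^7/5040 \<le> sin x"
proof -
  have "(\<Sum>m<7. sin_coeff m * x ^ m) = x - x^3/6 + x^5/120"
    by (simp add: eval_nat_numeral sin_coeff_Suc cos_coeff_Suc)
  with Maclaurin_sin_bound[of x 7] assms have "\<bar>sin x - (x - x^3/6 + x^5/120)\<bar> \<le> x^7/5040"
    by (simp add: fact_numeral)
  then show ?thesis by linarith
qed

text \<open>The value \<open>sin (pi / 6) = 1 / 2\<close> is compared with the Taylor bounds at a
  sixth of each decimal.\<close>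

lemma pi_bounds: "3.1415 < pi" "pi < 3.1416"
proof -
  have "\<not> pi \<le> 3.1415"
  proof
    assume "pi \<le> 3.1415"
    then have "sin (pi/6) \<le> sin (3.1415/6)"
      using pi_gt3 by (intro sin_monotone_2pi_le) auto
    also have "\<dots> < 1/2"
      using sin_le_poly5[of "3.1415/6"] by (simp add: power_divide)
    finally show False by (simp add: sin_30)
  qed
  then show "3.1415 < pi" by simp
  have "\<not> 3.1416 \<le> pi"
  proof
    assume *: "3.1416 \<le> pi"
    have "1/2 < sin (3.1416/6 :: real)"
      using sin_ge_poly7[of "3.1416/6"] by (simp add: power_divide)
    also have "\<dots> \<le> sin (pi/6)"
      using * by (intro sin_monotone_2pi_le) auto
    finally show False by (simp add: sin_30)
  qed
  then show "pi < 3.1416" by simp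
qed

text \<open>The left side starts the Laurent series of the cosecant; its product with the upper
  Taylor bound for sine stays below 1. The range ends just above \<open>pi / 2\<close>.\<close>

lemma csc_lower:
  fixes x :: real
  assumes "0 < x" "x \<le> 1.5708"
  shows "1/x + x/6 + 7*x^3/360 \<le> 1 / sin x"
proof -
  have pos: "0 < sin x" using assms pi_bounds by (intro sin_gt_zero) auto
  have z: "x^2 \<le> 9" using assms power_mono[of x 3 2] by simp
  have "(1/x + x/6 + 7*x^3/360) * sin x \<le> (1/x + x/6 + 7*x^3/360) * (x - x^3/6 + x^5/120)"
    using assms sin_le_poly5[of x] by (intro mult_left_mono) auto
  also have "\<dots> = 1 - x^6 * (1/540 - 7 * x^2/43200)"
    using assms by (simp add: field_simps power2_eq_square eval_nat_numeral)
  also have "\<dots> \<le> 1"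
    using z by (simp add: mult_nonneg_nonneg)
  finally show ?thesis using pos by (simp add: pos_le_divide_eq)
qed

text \<open>The next Laurent coefficient, 31/15120, is enlarged to 3/1000 to absorb the tail of the
  series on this range.\<close>

lemma csc_upper:
  fixes x :: real
  assumes "0 < x" "x \<le> 1.5708"
  shows "1 / sin x \<le> 1/x + x/6 + 7*x^3/360 + 3*x^5/1000"
proof -
  have pos: "0 < sin x" using assms pi_bounds by (intro sin_gt_zero) auto
  define z where "z = x^2"
  have z: "0 \<le> z" "z \<le> 2.4675"
    using assms power_mono[of x "1.5708" 2] by (auto simp: z_def power_divide)
  have Q: "0 \<le> 359/378000 - 561/1512000 * z + z^2 * (137/6480000 - z / 1680000)"
  proof -
    have "0 \<le> z^2 * (137/6480000 - z / 1680000)" using z by (intro mult_nonneg_nonneg) auto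
    moreover have "0 \<le> 359/378000 - 561/1512000 * z" using z by simp
    ultimately show ?thesis by linarith
  qed
  have "1 \<le> 1 + z^3 * (359/378000 - 561/1512000 * z + z^2 * (137/6480000 - z / 1680000))"
    using Q z by simp
  also have "\<dots> = (1/x + x/6 + 7*x^3/360 + 3*x^5/1000) * (x - x^3/6 + x^5/120 - x^7/5040)"
    using assms by (simp add: z_def field_simps eval_nat_numeral)
  also have "\<dots> \<le> (1/x + x/6 + 7*x^3/360 + 3*x^5/1000) * sin x"
    using assms sin_ge_poly7[of x] by (intro mult_left_mono) auto
  finally show ?thesis using pos by (simp add: pos_divide_le_eq)
qed

section \<open>Numerical bounds for \<open>n = 24\<close> and \<open>n = 52\<close>\<close>

lemma csc_sum_even:
  assumes "m > 0"
  shows "csc_sum (2*m) = 1 + 2 * (\<Sum>d=1..<m. 1 / sin (pi * real d / real (2*m)))"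
proof -
  have "{1..<2*m} = {1..<m} \<union> {m} \<union> {m<..<2*m}" using assms by auto
  \<comment> \<open>Reflection about \<open>m\<close> preserves the sine; the middle term is
    \<open>1 / sin (pi / 2) = 1\<close>.\<close>
  moreover have "(\<Sum>d\<in>{m<..<2*m}. 1 / sin (pi * real d / real (2*m))) = (\<Sum>d=1..<m. 1 / sin (pi * real d / real (2*m)))"
  proof (rule sum.reindex_bij_witness[of _ "\<lambda>d. 2*m - d" "\<lambda>d. 2*m - d"])
    fix d assume d: "d \<in> {m<..<2*m}"
    then have "pi * real (2*m - d) / real (2*m) = pi - pi * d / real (2*m)"
      by (simp add: field_simps)
    then show "1 / sin (pi * real (2*m - d) / real (2*m)) = 1 / sin (pi * real d / real (2*m))"
      by simp
  qed auto
  ultimately show ?thesis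
    using assms unfolding csc_sum_def by (subst \<open>{1..<2*m} = _\<close>) (subst sum.union_disjoint; auto)+
qed

text \<open>The bound is \<open>24 * 2.09\<close>, where 2.09 lies just above
  \<open>(16 * sqrt 2 - 8) / 7\<close>.\<close>

lemma csc_sum_24: "50.16 < csc_sum 24"
proof -
  have "(\<Sum>d=1..<12. 24 / (3.1416 * real d) + (3.1415 * real d / 24) / 6 + 7 * (3.1415 * real d / 24)^3/360)
     \<le> (\<Sum>d=1..<12. 1 / sin (pi * real d / 24))"
  proof (rule sum_mono)
    fix d :: nat assume d: "d \<in> {1..<12}"
    let ?x = "pi * real d / 24"
    have "24 / (3.1416 * real d) + (3.1415 * real d / 24) / 6 + 7 * (3.1415 * real d / 24)^3/360
        \<le> 1/?x + ?x/6 + 7*?x^3/360"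
      using d pi_bounds by (intro add_mono divide_right_mono mult_left_mono power_mono) (auto simp: field_simps)
    also have "\<dots> \<le> 1 / sin ?x"
    proof (rule csc_lower)
      have "pi * real d \<le> 3.1416 * 12" using d pi_bounds by (intro mult_mono) auto
      then show "?x \<le> 1.5708" by simp
    qed (use d in auto)
    finally show "24 / (3.1416 * real d) + (3.1415 * real d / 24) / 6 + 7 * (3.1415 * real d / 24)^3/360 \<le> 1 / sin ?x" .
  qed
  moreover have "24.6 < (\<Sum>d=1..<12. 24 / (3.1416 * real d) + (3.1415 * real d / 24) / 6 + 7 * (3.1415 * real d / 24)^3/360)"
    by (simp add: eval_nat_numeral)
  ultimately show ?thesis using csc_sum_even[of 12] by simp
qed

text \<open>The bound is \<open>52 * (3 * 1.732 / 2)\<close>, the upper threshold with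
  \<open>sqrt 3\<close> rounded down.\<close>

lemma csc_sum_52: "csc_sum 52 < 135.096"
proof -
  have "(\<Sum>d=1..<26. 1 / sin (pi * real d / 52)) \<le>
     (\<Sum>d=1..<26. 52 / (3.1415 * real d) + (3.1416 * real d / 52) / 6 + 7 * (3.1416 * real d / 52)^3/360 + 3 * (3.1416 * real d / 52)^5/1000)"
  proof (rule sum_mono)
    fix d :: nat assume d: "d \<in> {1..<26}"
    let ?x = "pi * real d / 52"
    have "1 / sin ?x \<le> 1/?x + ?x/6 + 7*?x^3/360 + 3*?x^5/1000"
    proof (rule csc_upper)
      have "pi * real d \<le> 3.1416 * 26" using d pi_bounds by (intro mult_mono) auto
      then show "?x \<le> 1.5708" by simp
    qed (use d in auto)
    also have "\<dots> \<le> 52 / (3.1415 * real d) + (3.1416 * real d / 52) / 6 + 7 * (3.1416 * real d / 52)^3/360 + 3 * (3.1416 * real d / 52)^5/1000"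
      using d pi_bounds by (intro add_mono divide_right_mono mult_left_mono power_mono) (auto simp: field_simps)
    finally show "1 / sin ?x \<le> 52 / (3.1415 * real d) + (3.1416 * real d / 52) / 6 + 7 * (3.1416 * real d / 52)^3/360 + 3 * (3.1416 * real d / 52)^5/1000" .
  qed
  moreover have "(\<Sum>d=1..<26. 52 / (3.1415 * real d) + (3.1416 * real d / 52) / 6 + 7 * (3.1416 * real d / 52)^3/360 + 3 * (3.1416 * real d / 52)^5/1000) < 67.04"
    by (simp add: eval_nat_numeral)
  ultimately show ?thesis using csc_sum_even[of 26] by simp
qed

section \<open>Growth of the mean \<open>csc_sum n / n\<close>\<close>

text \<open>Sine is positive and concave here, and the reciprocal is decreasing and convex, so the
  composition is convex.\<close>

lemma csc_convex:
  assumes "x \<in> {0<..<pi}" "y \<in> {0<..<pi}" "0 \<le> u" "0 \<le> v" "u + v = 1"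
  shows "1 / sin (u * x + v * y) \<le> u / sin x + v / sin y"
proof -
  have u: "u = 1 - v" using assms by simp
  have "convex_on {0..pi} (\<lambda>x. - sin x)"
    by (rule f''_ge0_imp_convex[where f' = "\<lambda>x. - cos x" and f'' = sin])
       (auto intro!: derivative_eq_intros sin_ge_zero)
  from convex_onD[OF this, of v x y] assms
  have sin: "u * sin x + v * sin y \<le> sin (u * x + v * y)"
    by (simp add: u)
  have pos: "0 < sin x" "0 < sin y" using assms by (auto intro: sin_gt_zero)
  have "convex_on {0<..} (inverse :: real \<Rightarrow> real)"
    by (rule convex_on_inverse) auto
  from convex_onD[OF this, of v "sin x" "sin y"] assms pos
  have inv: "inverse (u * sin x + v * sin y) \<le> u * inverse (sin x) + v * inverse (sin y)"
    by (simp add: u)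
  have "0 < u * sin x + v * sin y"
    using assms pos by (metis add_pos_nonneg add_nonneg_pos mult_pos_pos mult_nonneg_nonneg less_eq_real_def zero_neq_one add_0)
  then have "inverse (sin (u * x + v * y)) \<le> inverse (u * sin x + v * sin y)"
    using sin by (intro le_imp_inverse_le)
  with inv show ?thesis by (simp add: field_simps)
qed

text \<open>
  The point \<open>r / n\<close> is the convex combination of \<open>r / (n + 1)\<close> and \<open>(r + 1) / (n + 1)\<close> with weights
  \<open>(n - r) / n\<close> and \<open>r / n\<close>; each node \<open>s / (n + 1)\<close> then receives total weight \<open>(n - 1) / n\<close>.
\<close>

lemma csc_sum_mean_Suc:
  assumes "2 \<le> n"
  shows "csc_sum n / n \<le> csc_sum (Suc n) / Suc n"
proof -
  define f where "f m d = 1 / sin (pi * real d / real m)" for m d :: nat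
  have arg: "pi * real d / real m \<in> {0<..<pi}" if "d \<in> {1..<m}" for m d
    using that by (auto simp: field_simps)
  have f_pos: "0 < f m d" if "d \<in> {1..<m}" for m d
    unfolding f_def using arg[OF that] by (auto intro: sin_gt_zero)
  have "csc_sum n = (\<Sum>r=1..<n. f n r)" by (simp add: csc_sum_def f_def)
  also have "\<dots> \<le> (\<Sum>r=1..<n. (n - r) / n * f (Suc n) r + r / n * f (Suc n) (Suc r))"
  proof (rule sum_mono)
    fix r assume r: "r \<in> {1..<n}"
    have "pi * r / n = (n - r) / n * (pi * r / Suc n) + r / n * (pi * Suc r / Suc n)"
      using r by (simp add: divide_simps of_nat_diff del: of_nat_Suc) (simp add: algebra_simps)
    moreover have "1 / sin ((n - r) / n * (pi * r / Suc n) + r / n * (pi * Suc r / Suc n))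
        \<le> (n - r) / n / sin (pi * r / Suc n) + r / n / sin (pi * Suc r / Suc n)"
      using r arg[of r "Suc n"] arg[of "Suc r" "Suc n"]
      by (intro csc_convex) (auto simp: of_nat_diff diff_divide_distrib)
    ultimately show "f n r \<le> (n - r) / n * f (Suc n) r + r / n * f (Suc n) (Suc r)"
      by (simp add: f_def)
  qed
  also have "\<dots> = (\<Sum>r=1..<n. (n - r) / n * f (Suc n) r) + (\<Sum>r=2..<Suc n. (r - 1) / n * f (Suc n) r)"
  proof -
    have "(\<Sum>r=1..<n. r / n * f (Suc n) (Suc r)) = (\<Sum>r=Suc 1..<Suc n. (r - 1) / n * f (Suc n) r)"
      by (subst sum.shift_bounds_Suc_ivl) simp
    then show ?thesis by (simp add: sum.distrib numeral_2_eq_2)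
  qed
  \<comment> \<open>The added terms have weight 0: \<open>r = n\<close> in the first sum,
    \<open>r = 1\<close> in the second.\<close>
  also have "\<dots> = (\<Sum>r=1..<Suc n. (n - r) / n * f (Suc n) r) + (\<Sum>r=1..<Suc n. (r - 1) / n * f (Suc n) r)"
  proof -
    have "(\<Sum>r=2..<Suc n. (r - 1) / n * f (Suc n) r) = (\<Sum>r=1..<Suc n. (r - 1) / n * f (Suc n) r)"
      by (rule sum.mono_neutral_left) (auto simp: not_le less_Suc_eq)
    then show ?thesis using assms by simp
  qed
  also have "\<dots> = (\<Sum>r=1..<Suc n. (n - 1) / n * f (Suc n) r)"
    unfolding sum.distrib[symmetric] using assms
    by (intro sum.cong refl) (auto simp: field_simps of_nat_diff)
  also have "\<dots> = (n - 1) / n * csc_sum (Suc n)"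
    by (simp only: sum_distrib_left csc_sum_def f_def)
  \<comment> \<open>This rests on \<open>(n - 1) * (n + 1) \<le> n * n\<close>.\<close>
  also have "\<dots> \<le> n / Suc n * csc_sum (Suc n)"
  proof (rule mult_right_mono)
    show "0 \<le> csc_sum (Suc n)"
      using f_pos[of _ "Suc n"] unfolding csc_sum_def f_def by (intro sum_nonneg) (simp add: less_imp_le)
  qed (use assms in \<open>simp add: field_simps of_nat_diff\<close>)
  finally show ?thesis using assms by (simp add: field_simps)
qed

lemma csc_sum_mean_mono:
  assumes "2 \<le> m" "m \<le> n"
  shows "csc_sum m / m \<le> csc_sum n / n"
  using assms(2)
proof (induction rule: dec_induct)
  case (step k)
  with csc_sum_mean_Suc[of k] assms(1) show ?case by linarith
qed simp

section \<open>Centred bipyramids\<close>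

definition bipyramid :: "nat \<Rightarrow> real \<Rightarrow> nat \<Rightarrow> real ^ 3" where
  "bipyramid n h k =
     (if k \<le> n then vector [cos (2 * pi * real k / real n), sin (2 * pi * real k / real n), 0]
      else if k = n + 1 then 0
      else if k = n + 2 then vector [0, 0, h]
      else vector [0, 0, - h])"

definition bipyramid_mass :: "nat \<Rightarrow> real \<Rightarrow> real \<Rightarrow> real \<Rightarrow> nat \<Rightarrow> real" where
  "bipyramid_mass n x w y k = (if k \<le> n then x else if k = n + 1 then w else y)"

section \<open>Sums over the regular polygon\<close>

text \<open>Indexing by the offset \<open>k - j\<close> modulo \<open>n\<close> makes a sum over the
  vertices independent of the vertex \<open>k\<close> at which it is taken.\<close>

lemma sum_periodic:
  fixes F :: "int \<Rightarrow> 'a::comm_monoid_add"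
  assumes "\<And>d. F (d + int n) = F d" and "k \<in> {1..n}"
  shows "(\<Sum>j=1..n. F (int k - int j)) = (\<Sum>d<n. F (int d))"
proof (rule sum.reindex_bij_witness[of _ "\<lambda>d. if d < k then k - d else k + n - d"
      "\<lambda>j. if j \<le> k then k - j else k + n - j"])
  fix j assume j: "j \<in> {1..n}"
  show "F (int (if j \<le> k then k - j else k + n - j)) = F (int k - int j)"
    using j assms(2) assms(1)[of "int k - int j"] by (auto simp: of_nat_diff algebra_simps)
qed (use assms(2) in \<open>auto split: if_splits\<close>)

lemma sum_roots_of_unity_cis:
  assumes "2 \<le> n"
  shows "(\<Sum>k=1..n. cis (2 * pi * real k / real n)) = 0"
proof -
  define z where "z = cis (2 * pi / n)"
  have "0 < sin (pi / n)"
    using assms by (intro sin_gt_zero) (auto simp: field_simps)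
  then have "cos (2 * (pi / n)) < 1"
    unfolding cos_double_sin by simp
  then have "z \<noteq> 1" by (auto simp: z_def complex_eq_iff)
  have pow: "z ^ k = cis (2 * pi * real k / real n)" for k
    by (simp add: z_def Complex.DeMoivre mult_ac)
  have "z ^ n = 1" using assms by (simp add: pow)
  then have "(\<Sum>k<n. z ^ k) = 0" using \<open>z \<noteq> 1\<close> by (simp add: geometric_sum)
  then have "(\<Sum>k<n. z ^ Suc k) = 0" by (simp flip: sum_distrib_left)
  moreover have "(\<Sum>k=1..n. z ^ k) = (\<Sum>k<n. z ^ Suc k)"
    by (rule sum.reindex_bij_witness[of _ Suc "\<lambda>k. k - 1"]) auto
  ultimately show ?thesis by (simp add: pow)
qed

lemma sum_ring_eq_0:
  assumes "2 \<le> n"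
  shows "(\<Sum>k=1..n. cos (2 * pi * real k / real n)) = 0"
    and "(\<Sum>k=1..n. sin (2 * pi * real k / real n)) = 0"
  using arg_cong[OF sum_roots_of_unity_cis[OF assms], of Re]
    arg_cong[OF sum_roots_of_unity_cis[OF assms], of Im] by simp_all

lemma norm_vector_3: "norm (vector [a, b, c] :: real ^ 3) = sqrt (a\<^sup>2 + b\<^sup>2 + c\<^sup>2)"
  by (simp add: norm_eq_sqrt_inner inner_vec_def sum_3 power2_eq_square)

lemma bipyramid_simps:
  "k \<in> {1..n} \<Longrightarrow> bipyramid n h k = vector [cos (2 * pi * real k / real n), sin (2 * pi * real k / real n), 0]"
  "bipyramid n h (n + 1) = 0"
  "bipyramid n h (n + 2) = vector [0, 0, h]"
  "bipyramid n h (n + 3) = vector [0, 0, - h]"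
  by (simp_all add: bipyramid_def)

lemma sum_bipyramid:
  fixes g :: "nat \<Rightarrow> 'a::comm_monoid_add"
  shows "(\<Sum>k=1..n+3. g k) = (\<Sum>k=1..n. g k) + g (n + 1) + g (n + 2) + g (n + 3)"
  by (simp add: eval_nat_numeral add_ac)

lemma vector_3_arith:
  "vector [a, b, c] - vector [a', b', c'] = (vector [a - a', b - b', c - c'] :: real ^ 3)"
  "vector [a, b, c] + vector [a', b', c'] = (vector [a + a', b + b', c + c'] :: real ^ 3)"
  "r *\<^sub>R vector [a, b, c] = (vector [r * a, r * b, r * c] :: real ^ 3)"
  "- vector [a, b, c] = (vector [- a, - b, - c] :: real ^ 3)"
  "0 = (vector [0, 0, 0] :: real ^ 3)"
  by (simp_all add: vec_eq_iff forall_3)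

lemma sum_vector_3:
  "(\<Sum>i\<in>I. vector [a i, b i, c i] :: real ^ 3) = vector [sum a I, sum b I, sum c I]"
  by (simp add: vec_eq_iff forall_3)

section \<open>Forces within the bipyramid\<close>

text \<open>In the frame at vertex \<open>k\<close>, the chord has radial component
  \<open>1 - cos \<delta>\<close> and tangential component \<open>sin \<delta>\<close>. The offset
  is an integer and may be negative, hence the absolute value in the length.\<close>

lemma ring_diff:
  fixes k j n :: nat
  defines "\<theta> \<equiv> 2 * pi * real k / real n"
    and "\<delta> \<equiv> 2 * pi * real_of_int (int k - int j) / real n"
  assumes "k \<in> {1..n}" "j \<in> {1..n}"
  shows "bipyramid n h k - bipyramid n h j =
    vector [(1 - cos \<delta>) * cos \<theta> - sin \<delta> * sin \<theta>, (1 - cos \<delta>) * sin \<theta> + sin \<delta> * cos \<theta>, 0]"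
    and "norm (bipyramid n h k - bipyramid n h j) = 2 * \<bar>sin (\<delta> / 2)\<bar>"
proof -
  have j: "2 * pi * real j / real n = \<theta> - \<delta>"
    by (simp add: \<theta>_def \<delta>_def field_simps diff_divide_distrib)
  show *: "bipyramid n h k - bipyramid n h j =
    vector [(1 - cos \<delta>) * cos \<theta> - sin \<delta> * sin \<theta>, (1 - cos \<delta>) * sin \<theta> + sin \<delta> * cos \<theta>, 0]"
    using assms(3,4)
    by (simp add: bipyramid_simps vector_3_arith j cos_diff sin_diff flip: \<theta>_def)
       (simp add: algebra_simps)
  have c: "cos \<delta> = 1 - 2 * (sin (\<delta> / 2))\<^sup>2" using cos_double_sin[of "\<delta> / 2"] by simp
  have "((1 - cos \<delta>) * cos \<theta> - sin \<delta> * sin \<theta>)\<^sup>2 + ((1 - cos \<delta>) * sin \<theta> + sin \<delta> * cos \<theta>)\<^sup>2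
      = ((1 - cos \<delta>)\<^sup>2 + (sin \<delta>)\<^sup>2) * ((sin \<theta>)\<^sup>2 + (cos \<theta>)\<^sup>2)"
    by algebra
  also have "\<dots> = 2 - 2 * cos \<delta>"
    using sin_cos_squared_add[of \<delta>] by (simp add: power2_eq_square algebra_simps)
  also have "\<dots> = (2 * sin (\<delta> / 2))\<^sup>2" by (simp add: c power2_eq_square)
  finally show "norm (bipyramid n h k - bipyramid n h j) = 2 * \<bar>sin (\<delta> / 2)\<bar>"
    by (simp add: * norm_vector_3 real_sqrt_mult)
qed

text \<open>Offsets \<open>d\<close> and \<open>n - d\<close> have opposite tangential parts, so
  only the radial parts survive; with \<open>u\<close> the sine of the half angle each is
  \<open>2 * u^2 / (2 * u)^3 = 1 / (4 * u)\<close>.\<close>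

lemma ring_force:
  assumes k: "k \<in> {1..n}"
  shows "(\<Sum>j=1..n. (1 / norm (bipyramid n h k - bipyramid n h j) ^ 3) *\<^sub>R (bipyramid n h k - bipyramid n h j))
     = (csc_sum n / 4) *\<^sub>R bipyramid n h k"
proof -
  define \<theta> where "\<theta> = 2 * pi * real k / real n"
  define D where "D d = (2 * \<bar>sin (2 * pi * real_of_int d / real n / 2)\<bar>) ^ 3" for d :: int
  define F where "F d = (1 - cos (2 * pi * real_of_int d / real n)) / D d" for d :: int
  define G where "G d = sin (2 * pi * real_of_int d / real n) / D d" for d :: int
  have n: "0 < n" using k by auto
  \<comment> \<open>Adding \<open>n\<close> to the offset adds \<open>pi\<close> to the half angle,
    so its sine changes sign; the absolute value in \<open>D\<close> removes this.\<close>
  have shift: "2 * pi * real_of_int (d + int n) / real n = 2 * pi * real_of_int d / real n + 2 * pi"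
    "(2 * pi * real_of_int d / real n + 2 * pi) / 2 = 2 * pi * real_of_int d / real n / 2 + pi" for d
    using n by (simp_all add: field_simps)
  have D: "D (d + int n) = D d" for d unfolding D_def shift by simp
  have F: "F (d + int n) = F d" for d unfolding F_def D shift by simp
  have G: "G (d + int n) = G d" for d unfolding G_def D shift by simp
  \<comment> \<open>Offset 0, the vertex itself, contributes nothing: the numerator of
    \<open>F 0\<close> is \<open>1 - cos 0 = 0\<close>.\<close>
  have "(\<Sum>d<n. F (int d)) = (\<Sum>d=1..<n. F (int d))"
    using n by (simp add: F_def lessThan_atLeast0 sum.atLeast_Suc_lessThan)
  also have "\<dots> = (\<Sum>d=1..<n. 1 / sin (pi * real d / real n) / 4)"
  proof (rule sum.cong[OF refl])
    fix d assume d: "d \<in> {1..<n}"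
    let ?s = "sin (pi * real d / real n)"
    have "0 < ?s" using d by (intro sin_gt_zero) (auto simp: field_simps)
    moreover have "1 - cos (2 * pi * real d / real n) = 2 * ?s\<^sup>2"
      using cos_double_sin[of "pi * real d / real n"] by (simp add: mult_ac)
    ultimately show "F (int d) = 1 / ?s / 4"
      unfolding F_def D_def of_int_of_nat_eq
      by (simp add: power2_eq_square power3_eq_cube)
  qed
  also have "\<dots> = csc_sum n / 4" by (simp add: csc_sum_def sum_divide_distrib)
  finally have sumF: "(\<Sum>d<n. F (int d)) = csc_sum n / 4" .
  have "(\<Sum>d=1..<n. G (int d)) = (\<Sum>d=1..<n. - G (int d))"
  proof (rule sum.reindex_bij_witness[of _ "\<lambda>d. n - d" "\<lambda>d. n - d"])
    fix d assume "d \<in> {1..<n}"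
    then have "int (n - d) = - int d + int n" by auto
    then have "G (int (n - d)) = G (- int d)" using G by metis
    then show "- G (int (n - d)) = G (int d)" by (simp add: G_def D_def)
  qed auto
  then have "(\<Sum>d=1..<n. G (int d)) = 0" by (simp add: sum_negf)
  moreover have "(\<Sum>d<n. G (int d)) = (\<Sum>d=1..<n. G (int d))"
    using n by (simp add: G_def lessThan_atLeast0 sum.atLeast_Suc_lessThan)
  ultimately have sumG: "(\<Sum>d<n. G (int d)) = 0" by simp
  have "(\<Sum>j=1..n. (1 / norm (bipyramid n h k - bipyramid n h j) ^ 3) *\<^sub>R (bipyramid n h k - bipyramid n h j))
    = (\<Sum>j=1..n. vector [F (int k - int j) * cos \<theta> - G (int k - int j) * sin \<theta>,
         F (int k - int j) * sin \<theta> + G (int k - int j) * cos \<theta>, 0])"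
  proof (rule sum.cong[OF refl])
    fix j assume j: "j \<in> {1..n}"
    have D: "norm (bipyramid n h k - bipyramid n h j) ^ 3 = D (int k - int j)"
      unfolding ring_diff(2)[OF k j] D_def ..
    show "(1 / norm (bipyramid n h k - bipyramid n h j) ^ 3) *\<^sub>R (bipyramid n h k - bipyramid n h j)
      = vector [F (int k - int j) * cos \<theta> - G (int k - int j) * sin \<theta>,
         F (int k - int j) * sin \<theta> + G (int k - int j) * cos \<theta>, 0]"
      unfolding D unfolding ring_diff(1)[OF k j]
      by (simp add: vector_3_arith F_def G_def flip: \<theta>_def)
        (simp add: algebra_simps diff_divide_distrib add_divide_distrib)
  qed
  also have "\<dots> = vector [csc_sum n / 4 * cos \<theta>, csc_sum n / 4 * sin \<theta>, 0]"
    unfolding sum_vector_3 sum.distrib sum_subtractf sum_distrib_right[symmetric]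
      sum_periodic[of F n k, OF F k] sum_periodic[of G n k, OF G k] sumF sumG by simp
  also have "\<dots> = (csc_sum n / 4) *\<^sub>R bipyramid n h k"
    using k by (simp add: bipyramid_simps vector_3_arith \<theta>_def)
  finally show ?thesis .
qed

text \<open>The factor \<open>M k\<close> is pulled out, and the self-term \<open>j = k\<close> may
  be included because its vector \<open>c k - c k\<close> is zero.\<close>

lemma cc_equationI:
  assumes "\<And>k. k \<in> {1..N} \<Longrightarrow>
    (\<Sum>j=1..N. (M j / norm (c k - c j) ^ 3) *\<^sub>R (c k - c j)) = - l *\<^sub>R c k"
  shows "cc_equation N M l c"
  unfolding cc_equation_def
proof
  fix k assume k: "k \<in> {1..N}"
  have "(\<Sum>j\<in>{1..N} - {k}. (M k * M j / norm (c k - c j) ^ 3) *\<^sub>R (c k - c j))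
      = M k *\<^sub>R (\<Sum>j\<in>{1..N} - {k}. (M j / norm (c k - c j) ^ 3) *\<^sub>R (c k - c j))"
    by (simp add: scaleR_sum_right)
  also have "(\<Sum>j\<in>{1..N} - {k}. (M j / norm (c k - c j) ^ 3) *\<^sub>R (c k - c j))
      = (\<Sum>j=1..N. (M j / norm (c k - c j) ^ 3) *\<^sub>R (c k - c j))"
    by (rule sum.mono_neutral_left) auto
  finally show "(l * M k) *\<^sub>R c k = - (\<Sum>j\<in>{1..N} - {k}. (M k * M j / norm (c k - c j) ^ 3) *\<^sub>R (c k - c j))"
    using assms[OF k] by (simp add: mult.commute)
qed

lemma sum_ring: "2 \<le> n \<Longrightarrow> (\<Sum>k=1..n. bipyramid n h k) = 0"
  by (subst sum.cong[OF refl bipyramid_simps(1)], assumption)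
    (simp add: sum_vector_3 sum_ring_eq_0 vector_3_arith(5) del: One_nat_def)

text \<open>The vertices sum to zero, so the vectors from them to an equidistant point
  \<open>p\<close> add up to \<open>n\<close> times \<open>p\<close>.\<close>

lemma axis_force:
  assumes "2 \<le> n" and "\<And>j. j \<in> {1..n} \<Longrightarrow> norm (p - bipyramid n h j) = r"
  shows "(\<Sum>j=1..n. (x / norm (p - bipyramid n h j) ^ 3) *\<^sub>R (p - bipyramid n h j)) = (n * x / r ^ 3) *\<^sub>R p"
proof -
  have "(\<Sum>j=1..n. (x / norm (p - bipyramid n h j) ^ 3) *\<^sub>R (p - bipyramid n h j))
      = (x / r ^ 3) *\<^sub>R (\<Sum>j=1..n. p - bipyramid n h j)"
    using assms(2) by (simp add: scaleR_sum_right)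
  also have "\<dots> = (n * x / r ^ 3) *\<^sub>R p"
    unfolding sum_subtractf sum_ring[OF assms(1)] by (simp add: sum_constant_scaleR del: sum_constant)
  finally show ?thesis .
qed

text \<open>Here \<open>s\<close> is the inverse cube of the distance from pole to vertex. On the
  polygon the axial pulls of the poles cancel, and at the centre all pulls do. The last term of
  \<open>pole\<close> is the opposite pole's \<open>y * 2 * h / (2 * h) ^ 3\<close>, divided by
  \<open>h\<close>.\<close>

lemma bipyramid_cc_equation:
  assumes n: "2 \<le> n" and h: "0 < h"
    and s: "s = 1 / sqrt (1 + h\<^sup>2) ^ 3"
    and ring: "csc_sum n / 4 * x + w + 2 * s * y = - l"
    and pole: "n * s * x + w / h ^ 3 + y / (4 * h ^ 3) = - l"
  shows "cc_equation (n + 3) (bipyramid_mass n x w y) l (bipyramid n h)"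
proof (rule cc_equationI)
  \<comment> \<open>Rescaling by \<open>h ^ 3\<close> makes the left side of \<open>pole\<close>
    polynomial in the unknowns.\<close>
  define W Y where "W = w / h ^ 3" and "Y = y / h ^ 3"
  have wy: "w = W * h ^ 3" "y = Y * h ^ 3" using h by (simp_all add: W_def Y_def)
  have l: "- l = n * s * x + W + Y / 4" using pole by (simp add: W_def Y_def)
  have s': "n * x / sqrt (1 + h\<^sup>2) ^ 3 = n * s * x" by (simp add: s)
  fix k assume "k \<in> {1..n + 3}"
  then consider "k \<in> {1..n}" | "k = n + 1" | "k = n + 2" | "k = n + 3" by force
  then have "(\<Sum>j=1..n. (x / norm (bipyramid n h k - bipyramid n h j) ^ 3) *\<^sub>R (bipyramid n h k - bipyramid n h j))
     + (w / norm (bipyramid n h k) ^ 3) *\<^sub>R bipyramid n h k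
     + (y / norm (bipyramid n h k - vector [0, 0, h]) ^ 3) *\<^sub>R (bipyramid n h k - vector [0, 0, h])
     + (y / norm (bipyramid n h k - vector [0, 0, - h]) ^ 3) *\<^sub>R (bipyramid n h k - vector [0, 0, - h])
     = - l *\<^sub>R bipyramid n h k" (is "?R + _ + _ + _ = _")
  proof cases
    case 1
    have "?R = x *\<^sub>R (\<Sum>j=1..n. (1 / norm (bipyramid n h k - bipyramid n h j) ^ 3) *\<^sub>R (bipyramid n h k - bipyramid n h j))"
      by (simp add: scaleR_sum_right)
    also have "\<dots> = (x * (csc_sum n / 4)) *\<^sub>R bipyramid n h k"
      unfolding ring_force[OF 1] by simp
    finally have "?R = (x * (csc_sum n / 4)) *\<^sub>R bipyramid n h k" .
    then show ?thesis
      unfolding bipyramid_simps(1)[OF 1]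
      by (simp add: vector_3_arith norm_vector_3 s flip: ring) (simp add: algebra_simps)
  next
    case 2
    have R: "?R = (n * x / 1 ^ 3) *\<^sub>R bipyramid n h k"
      by (rule axis_force[OF n]) (simp add: 2 bipyramid_simps(1) bipyramid_simps(2)[simplified] norm_vector_3)
    show ?thesis
      unfolding R unfolding 2 bipyramid_simps by (simp add: vector_3_arith norm_vector_3)
  next
    case 3
    have R: "?R = (n * x / sqrt (1 + h\<^sup>2) ^ 3) *\<^sub>R bipyramid n h k"
      by (rule axis_force[OF n])
        (simp add: 3 bipyramid_simps(1) bipyramid_simps(3)[simplified] vector_3_arith norm_vector_3)
    show ?thesis
      unfolding R s' unfolding 3 bipyramid_simps
      unfolding l wy
      using h by (simp add: vector_3_arith norm_vector_3 real_sqrt_mult) (simp add: field_simps power3_eq_cube)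
  next
    case 4
    have R: "?R = (n * x / sqrt (1 + h\<^sup>2) ^ 3) *\<^sub>R bipyramid n h k"
      by (rule axis_force[OF n])
        (simp add: 4 bipyramid_simps(1) bipyramid_simps(4)[simplified] vector_3_arith norm_vector_3)
    show ?thesis
      unfolding R s' unfolding 4 bipyramid_simps
      unfolding l wy
      using h by (simp add: vector_3_arith norm_vector_3 real_sqrt_mult)
        (simp add: field_simps power3_eq_cube,
         rule arg_cong[where f = "\<lambda>a. vector [0, 0, a]"], simp add: field_simps)
  qed
  then show "(\<Sum>j=1..n+3. (bipyramid_mass n x w y j / norm (bipyramid n h k - bipyramid n h j) ^ 3) *\<^sub>R
      (bipyramid n h k - bipyramid n h j)) = - l *\<^sub>R bipyramid n h k"
    unfolding sum_bipyramid bipyramid_simps by (simp add: bipyramid_mass_def)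
qed

section \<open>Distinctness of the points, total mass and centre of mass\<close>

lemma configuration_bipyramid:
  assumes "0 < h"
  shows "configuration (n + 3) (bipyramid n h)"
proof -
  have ring: "bipyramid n h k \<noteq> bipyramid n h j" if "k \<in> {1..n}" "j \<in> {1..n}" "j < k" for k j
  proof -
    have "0 < sin (pi * real_of_int (int k - int j) / real n)"
      using that by (intro sin_gt_zero) (auto simp: pos_divide_less_eq)
    then show ?thesis using ring_diff(2)[OF that(1,2), of h] by auto
  qed
  have "bipyramid n h k \<noteq> bipyramid n h j" if kj: "k \<in> {1..n+3}" "j \<in> {1..n+3}" "j < k" for k j
  proof -
    consider "k \<in> {1..n}" "j \<in> {1..n}" | "j \<in> {1..n}" "n < k" | "n < j"
      using kj by (metis atLeastAtMost_iff not_le)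
    then show ?thesis
    proof cases
      case 2
      have "cos \<alpha> \<noteq> 0 \<or> sin \<alpha> \<noteq> 0" for \<alpha> :: real
        using sin_zero_abs_cos_one[of \<alpha>] by auto
      with 2 show ?thesis by (auto simp: bipyramid_def vec_eq_iff forall_3)
    next
      case 3
      with kj \<open>0 < h\<close> show ?thesis by (auto simp: bipyramid_def vec_eq_iff forall_3)
    qed (use ring kj in auto)
  qed
  then show ?thesis
    unfolding configuration_def inj_on_def by (metis linorder_neqE_nat)
qed

lemma total_mass_bipyramid:
  "total_mass (n + 3) (bipyramid_mass n x w y) = n * x + w + 2 * y"
  unfolding total_mass_def sum_bipyramid by (simp add: bipyramid_mass_def)

lemma center_of_mass_bipyramid:
  assumes "2 \<le> n"
  shows "center_of_mass (n + 3) (bipyramid_mass n x w y) (bipyramid n h) = 0"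
proof -
  have "(\<Sum>k=1..n+3. bipyramid_mass n x w y k *\<^sub>R bipyramid n h k) = 0"
    unfolding sum_bipyramid bipyramid_simps using sum_ring[OF assms, of h]
    by (simp add: bipyramid_mass_def vector_3_arith flip: scaleR_sum_right)
  then show ?thesis by (simp add: center_of_mass_def)
qed


section \<open>Two mass distributions on one bipyramid\<close>

lemma bipyramid_really_perverse:
  assumes n: "2 \<le> n" and h: "0 < h" "h < 1"
    and s: "s = 1 / sqrt (1 + h\<^sup>2) ^ 3"
    and t: "t = h ^ 3 * s" "1 / 8 < t"
    and balance: "8 * (s + t - s * t) * n = n + 7 * (csc_sum n / 4)"
  shows "really_perverse (n + 3) (bipyramid n h)"
proof -
  define A where "A = csc_sum n / 4"
  \<comment> \<open>Mass minus polygon equation reads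
    \<open>(n - A) * x' + 2 * (1 - s) * y' = 0\<close>, which fixes \<open>x'\<close> and
    \<open>y'\<close> up to scale; \<open>w'\<close> then follows from the mass equation. The pole
    equation, multiplied by \<open>h ^ 3\<close>, becomes \<open>balance\<close>.\<close>
  define x' y' w' where "x' = 2 * (1 - s)" and "y' = - (n - A)" and "w' = 2 * n * s - 2 * A"
  have "1 < sqrt (1 + h\<^sup>2)" using h by simp
  then have "1 < sqrt (1 + h\<^sup>2) ^ 3" by (intro one_less_power) auto
  then have "s < 1" unfolding s by (subst divide_less_eq_1_pos) (auto simp: add_pos_nonneg)
  then have x': "x' \<noteq> 0" by (simp add: x'_def)
  have mass': "n * x' + w' + 2 * y' = 0"
    by (simp add: x'_def y'_def w'_def algebra_simps)
  have ring': "A * x' + w' + 2 * s * y' = 0"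
    by (simp add: x'_def y'_def w'_def algebra_simps)
  have "n * t * x' + w' + y' / 4 = 0"
    using balance unfolding A_def[symmetric] by (simp add: x'_def y'_def w'_def field_simps)
  then have pole': "n * s * x' + w' / h ^ 3 + y' / (4 * h ^ 3) = 0"
    using h by (simp add: t field_simps)

  have h3: "0 < h ^ 3" "h ^ 3 < 1" using h by (auto simp: power_less_one_iff)
  text \<open>
    The excess of the coefficient of \<open>y\<close> in the polygon equation over that in the pole equation is
    positive, while for \<open>w\<close> it is negative as \<open>h < 1\<close>: a large \<open>y\<close> is balanced by a positive \<open>w\<close>.
  \<close>
  define e where "e = 2 * s - 1 / (4 * h ^ 3)"
  \<comment> \<open>Indeed \<open>4 * h ^ 3 * e = 8 * t - 1\<close>.\<close>
  have e: "0 < e" using t h3 by (simp add: e_def field_simps)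
  \<comment> \<open>With polygon masses 1, this gives
    \<open>e * y = \<bar>A - n * s\<bar> + 1\<close>, so the numerator of \<open>w\<close> is at
    least 1 whatever the sign of \<open>A - n * s\<close>.\<close>
  define y where "y = (\<bar>A - n * s\<bar> + 1) / e"
  define w where "w = (A - n * s + e * y) / (1 / h ^ 3 - 1)"
  have "0 < y" using e by (simp add: y_def divide_pos_pos add_nonneg_pos)
  have "0 < A - n * s + e * y" using e by (simp add: y_def)
  then have "0 < w" using h3 by (simp add: w_def)
  have w: "A + w + 2 * s * y = n * s + w / h ^ 3 + y / (4 * h ^ 3)"
  proof -
    have "w * (1 / h ^ 3 - 1) = A - n * s + e * y" using h3 by (simp add: w_def)
    then show ?thesis by (simp add: e_def algebra_simps)
  qed
  define l where "l = - (A + w + 2 * s * y)"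

  \<comment> \<open>Each perturbation becomes smaller than all of the masses 1, \<open>y\<close> and
    \<open>w\<close>; the summand 1 in the denominator makes this strict.\<close>
  define r where "r = min 1 (min y w) / (1 + \<bar>x'\<bar> + \<bar>y'\<bar> + \<bar>w'\<bar>)"
  have r: "0 < r" using \<open>0 < y\<close> \<open>0 < w\<close> by (simp add: r_def add_pos_nonneg)
  have small: "\<bar>r * u\<bar> < min 1 (min y w)" if "u \<in> {x', y', w'}" for u
  proof -
    have "\<bar>u\<bar> < 1 + \<bar>x'\<bar> + \<bar>y'\<bar> + \<bar>w'\<bar>" using that by auto
    then have "r * \<bar>u\<bar> < r * (1 + \<bar>x'\<bar> + \<bar>y'\<bar> + \<bar>w'\<bar>)" using r by simp
    also have "\<dots> = min 1 (min y w)" unfolding r_def by simp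
    finally show ?thesis using r by (simp add: abs_mult)
  qed
  define M where "M = bipyramid_mass n 1 w y"
  define M' where "M' = bipyramid_mass n (1 + r * x') (w + r * w') (y + r * y')"
  have "mass_distribution (n + 3) M" "mass_distribution (n + 3) M'"
    using \<open>0 < y\<close> \<open>0 < w\<close> small[of x'] small[of y'] small[of w']
    by (auto simp: mass_distribution_def M_def M'_def bipyramid_mass_def)
  moreover have "cc_equation (n + 3) M l (bipyramid n h)"
    unfolding M_def by (rule bipyramid_cc_equation[OF n h(1) s]) (use w in \<open>simp_all add: l_def A_def\<close>)
  moreover have "cc_equation (n + 3) M' l (bipyramid n h)"
    unfolding M'_def
  proof (rule bipyramid_cc_equation[OF n h(1) s])
    have "A * (1 + r * x') + (w + r * w') + 2 * s * (y + r * y')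
        = A + w + 2 * s * y + r * (A * x' + w' + 2 * s * y')" by (simp add: algebra_simps)
    then show "csc_sum n / 4 * (1 + r * x') + (w + r * w') + 2 * s * (y + r * y') = - l"
      by (simp only: ring' l_def A_def[symmetric])
    have "n * s * (1 + r * x') + (w + r * w') / h ^ 3 + (y + r * y') / (4 * h ^ 3)
        = n * s + w / h ^ 3 + y / (4 * h ^ 3) + r * (n * s * x' + w' / h ^ 3 + y' / (4 * h ^ 3))"
      by (simp add: algebra_simps add_divide_distrib)
    then show "n * s * (1 + r * x') + (w + r * w') / h ^ 3 + (y + r * y') / (4 * h ^ 3) = - l"
      by (simp add: pole' l_def w)
  qed
  moreover have "configuration (n + 3) (bipyramid n h)"
    using h(1) by (rule configuration_bipyramid)
  moreover have "M 1 \<noteq> M' 1" using n r x' by (simp add: M_def M'_def bipyramid_mass_def)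
  then have "\<exists>k\<in>{1..n + 3}. M k \<noteq> M' k" using n by (intro bexI[of _ 1]) auto
  moreover have "total_mass (n + 3) M = total_mass (n + 3) M'"
  proof -
    have "n * (1 + r * x') + (w + r * w') + 2 * (y + r * y') = n + w + 2 * y + r * (n * x' + w' + 2 * y')"
      by (simp add: algebra_simps)
    then show ?thesis by (simp add: M_def M'_def total_mass_bipyramid mass')
  qed
  moreover have "center_of_mass (n + 3) M (bipyramid n h) = center_of_mass (n + 3) M' (bipyramid n h)"
    by (simp add: M_def M'_def center_of_mass_bipyramid[OF n])
  ultimately show ?thesis
    unfolding really_perverse_def central_configuration_def by blast
qed

section \<open>Choice of the height\<close>

text \<open>At \<open>pi / 6\<close> the condition \<open>1 / 8 < sin \<theta> ^ 3\<close>
  degenerates, at \<open>pi / 4\<close> the condition \<open>tan \<theta> < 1\<close>. The bounds on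
  \<open>csc_sum n / n\<close> say that the target value lies strictly between those of
  \<open>f\<close> at these ends, so the root is interior.\<close>

lemma exists_bipyramid_really_perverse:
  assumes n: "2 \<le> n" and lower: "(16 * sqrt 2 - 8) / 7 < csc_sum n / n" and upper: "csc_sum n / n < 3 * sqrt 3 / 2"
  shows "\<exists>h. really_perverse (n + 3) (bipyramid n h)"
proof -
  define a where "a = csc_sum n / n"
  define f where "f \<theta> = 8 * (cos \<theta> ^ 3 + sin \<theta> ^ 3 - cos \<theta> ^ 3 * sin \<theta> ^ 3)" for \<theta> :: real
  have f6: "f (pi / 6) = 1 + 21 * sqrt 3 / 8"
    by (simp add: f_def cos_30 sin_30 power3_eq_cube field_simps)
  have f4: "f (pi / 4) = 4 * sqrt 2 - 1"
    by (simp add: f_def cos_45 sin_45 power3_eq_cube field_simps)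
  have "f (pi / 4) < 1 + 7 / 4 * a"
    using lower unfolding f4 a_def[symmetric] by simp
  moreover have "1 + 7 / 4 * a < f (pi / 6)"
    using upper unfolding f6 a_def[symmetric] by simp
  ultimately have ends: "f (pi / 4) < 1 + 7 / 4 * a" "1 + 7 / 4 * a < f (pi / 6)" .
  from ends obtain \<theta> where \<theta>: "pi / 6 \<le> \<theta>" "\<theta> \<le> pi / 4" "f \<theta> = 1 + 7 / 4 * a"
    using IVT2'[of f "pi / 4" "1 + 7 / 4 * a" "pi / 6"] unfolding f_def
    by (fastforce intro!: continuous_intros)
  have "\<theta> \<noteq> pi / 6" "\<theta> \<noteq> pi / 4" using \<theta>(3) ends by (metis less_irrefl)+
  with \<theta> have strict: "pi / 6 < \<theta>" "\<theta> < pi / 4" by auto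
  have cos: "0 < cos \<theta>" using strict by (intro cos_gt_zero) auto
  have "1 / 2 < sin \<theta>"
    using sin_monotone_2pi[of "pi / 6" \<theta>] strict by (simp add: sin_30)
  then have sin3: "1 / 8 < sin \<theta> ^ 3"
    using power_strict_mono[of "1 / 2" "sin \<theta>" 3] by (simp add: power_divide)
  have tan: "0 < tan \<theta>" "tan \<theta> < 1"
    using strict tan_gt_zero[of \<theta>] tan_monotone[of \<theta> "pi / 4"] by (auto simp: tan_45)
  have "sqrt (1 + (tan \<theta>)\<^sup>2) = 1 / cos \<theta>"
    using cos tan_sec[of \<theta>] by (intro real_sqrt_unique) (auto simp: inverse_eq_divide power_divide)
  then have s: "cos \<theta> ^ 3 = 1 / sqrt (1 + (tan \<theta>)\<^sup>2) ^ 3"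
    by (simp add: power_divide)
  have t: "sin \<theta> ^ 3 = tan \<theta> ^ 3 * cos \<theta> ^ 3"
    using cos by (simp add: tan_def power_divide)
  have "8 * (cos \<theta> ^ 3 + sin \<theta> ^ 3 - cos \<theta> ^ 3 * sin \<theta> ^ 3) * n = (1 + 7 / 4 * a) * n"
    using \<theta>(3) by (simp only: f_def)
  also have "\<dots> = n + 7 * (csc_sum n / 4)"
    using n by (simp add: a_def field_simps)
  finally show ?thesis
    using bipyramid_really_perverse[OF n tan s t sin3] by blast
qed

theorem theorem1:
  fixes N :: nat
  assumes "27 \<le> N" and "N \<le> 55"
  shows "\<exists>c. really_perverse N c"
proof -
  define n where "n = N - 3"
  have n: "24 \<le> n" "n \<le> 52" "N = n + 3" using assms by (auto simp: n_def)
  \<comment> \<open>This rounding suffices since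
    \<open>(16 * 1.41425 - 8) / 7 < 2.09\<close>.\<close>
  have "sqrt 2 < 1.41425" by (intro real_less_lsqrt) (auto simp: power_divide)
  then have "(16 * sqrt 2 - 8) / 7 < (50.16 / 24 :: real)" by simp
  also have "\<dots> < csc_sum 24 / 24" using csc_sum_24 by simp
  also have "\<dots> \<le> csc_sum n / n" using csc_sum_mean_mono[of 24 n] n by simp
  finally have lower: "(16 * sqrt 2 - 8) / 7 < csc_sum n / n" .
  have "csc_sum n / n \<le> csc_sum 52 / 52" using csc_sum_mean_mono[of n 52] n by simp
  also have "\<dots> < 135.096 / 52" using csc_sum_52 by simp
  also have "\<dots> < 3 * sqrt 3 / 2"
  proof -
    have "1.732 < sqrt 3" by (intro real_less_rsqrt) (simp add: power_divide)
    then show ?thesis by simp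
  qed
  finally have upper: "csc_sum n / n < 3 * sqrt 3 / 2" .
  show ?thesis
    using exists_bipyramid_really_perverse[OF _ lower upper] n by auto
qed

end
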